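(* Let $n$ be the number of qubits of the oracle, $N=2^n$, and let $k<n$. Consider the oracle decision problem $\Omega_{\mathrm{reflect}(k,n)}=(\Omega_{\mathrm{Yes}},\Omega_{\mathrm{No}})$ where $\Omega_{\mathrm{Yes}}=\{\mathcal O_S=\mathbb I-2\Pi_S : S\subseteq\mathbb C^N \text{ a nonzero subspace with } \dim S\le 2^k\}$ ($\Pi_S$ the orthogonal projector onto $S$) and $\Omega_{\mathrm{No}}=\{\mathbb I\}$. Suppose an $L$-query oracle verifier uniquely decides $\Omega_{\mathrm{reflect}(k,n)}$ with error $\varepsilon\in O(\exp(-n))$ (in particular it must work for every subspace $S$ of every dimension $1\le \dim S\le 2^k$). Then $L=\Omega(\sqrt{2^k})$. In particular, if $k=\Omega(n)$, the number of queries is exponential in $n$.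
   Context: An $L$-query oracle verifier acts on a witness register $R_{\mathrm{in}}$ and an auxiliary register $R_{\mathrm{aux}}$ initialized to $|0\cdots0\rangle$; $R_{\mathrm{aux}}$ contains an $n$-qubit oracle register $R_{\mathcal O}$ and a designated output qubit $R_{\mathrm{out}}$. Given an $n$-qubit unitary $\mathcal O$, on witness $|\omega\rangle$ the verifier applies $U_0$, then alternately a controlled query $\mathcal O^{\Pi}=(\mathbb I-\Pi)\otimes\mathbb I+\Pi\otimes\mathcal O$ (with $\mathcal O$ acting on $R_{\mathcal O}$ and $\Pi$ a projector on the remaining registers) and fixed unitaries $U_1,\dots,U_L$ (the $U_j$ and control projectors do not depend on $\mathcal O$), i.e. the state $U_L\mathcal O^{\Pi}U_{L-1}\cdots U_1\mathcal O^{\Pi}U_0(|\omega\rangle|0\cdots0\rangle)$, and finally measures $R_{\mathrm{out}}$ in the computational basis, accepting on outcome $1$; let $p_{\mathcal O}(\omega)$ be the acceptance probability. An oracle decision problem is a pair $(\Omega_{\mathrm{Yes}},\Omega_{\mathrm{No}})$ of disjoint sets of unitaries. The verifier uniquely decides it with error $\varepsilon$ if (i) for every $\mathcal O\in\Omega_{\mathrm{Yes}}$ there is a witness $|\omega\rangle$ with $p_{\mathcal O}(\omega)\ge1-\varepsilon$ and $p_{\mathcal O}(\omega')\le\varepsilon$ for every $|\omega'\rangle\perp|\omega\rangle$; (ii) for $\mathcal O\in\Omega_{\mathrm{No}}$, $p_{\mathcal O}(\omega)\le\varepsilon$ for all witnesses $|\omega\rangle$. The witness register may be of arbitrary size. 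*)

theory Defs
  imports "Jordan_Normal_Form.Matrix"
begin

text \<open>Kronecker (tensor) product; index convention: i = i_A * dim_B + i_B.\<close>
definition kron :: "complex mat \<Rightarrow> complex mat \<Rightarrow> complex mat" where
  "kron A B = mat (dim_row A * dim_row B) (dim_col A * dim_col B)
     (\<lambda>(i,j). A $$ (i div dim_row B, j div dim_col B) * B $$ (i mod dim_row B, j mod dim_col B))"

definition adj :: "complex mat \<Rightarrow> complex mat" where
  "adj A = mat (dim_col A) (dim_row A) (\<lambda>(i,j). cnj (A $$ (j,i)))"

definition unitary_mat :: "nat \<Rightarrow> complex mat \<Rightarrow> bool" where
  "unitary_mat d U \<longleftrightarrow> U \<in> carrier_mat d d \<and> adj U * U = 1\<^sub>m d"

definition proj_mat :: "nat \<Rightarrow> complex mat \<Rightarrow> bool" where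
  "proj_mat d P \<longleftrightarrow> P \<in> carrier_mat d d \<and> adj P = P \<and> P * P = P"

definition cinner :: "complex vec \<Rightarrow> complex vec \<Rightarrow> complex" where
  "cinner v w = (\<Sum>i<dim_vec v. cnj (v $ i) * w $ i)"

definition unit_state :: "nat \<Rightarrow> complex vec \<Rightarrow> bool" where
  "unit_state d v \<longleftrightarrow> dim_vec v = d \<and> cinner v v = 1"

text \<open>Register layout: full space = R_rest \<otimes> R_O, where
  R_rest = R_in (dim W) \<otimes> R_other (dim M, further ancillas) \<otimes> R_out (dim 2),
  R_O has dimension 2^n. R_aux = R_other \<otimes> R_out \<otimes> R_O.
  A full index is  i = ((w * M + m) * 2 + b) * 2^n + o.\<close>

definition full_dim :: "nat \<Rightarrow> nat \<Rightarrow> nat \<Rightarrow> nat" where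
  "full_dim n W M = W * M * 2 * 2^n"

definition cquery :: "complex mat \<Rightarrow> complex mat \<Rightarrow> complex mat" where
  "cquery P Q = kron (1\<^sub>m (dim_row P) - P) (1\<^sub>m (dim_row Q)) + kron P Q"

text \<open>Initial state |omega> \<otimes> |0...0>_aux.\<close>
definition init_state :: "nat \<Rightarrow> nat \<Rightarrow> complex vec \<Rightarrow> complex vec" where
  "init_state n M \<omega> = vec (dim_vec \<omega> * (M * 2 * 2^n))
     (\<lambda>i. if i mod (M * 2 * 2^n) = 0 then \<omega> $ (i div (M * 2 * 2^n)) else 0)"

fun run :: "(nat \<Rightarrow> complex mat) \<Rightarrow> (nat \<Rightarrow> complex mat) \<Rightarrow> complex mat \<Rightarrow> complex vec \<Rightarrow> nat \<Rightarrow> complex vec" where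
  "run U Ctl Q \<psi> 0 = U 0 *\<^sub>v \<psi>"
| "run U Ctl Q \<psi> (Suc j) = U (Suc j) *\<^sub>v (cquery (Ctl (Suc j)) Q *\<^sub>v run U Ctl Q \<psi> j)"

text \<open>Acceptance probability: probability that R_out is measured as 1.\<close>
definition acc_prob :: "nat \<Rightarrow> nat \<Rightarrow> nat \<Rightarrow> (nat \<Rightarrow> complex mat) \<Rightarrow> (nat \<Rightarrow> complex mat)
     \<Rightarrow> complex mat \<Rightarrow> complex vec \<Rightarrow> real" where
  "acc_prob n M L U Ctl Q \<omega> =
     (let \<psi> = run U Ctl Q (init_state n M \<omega>) L
      in \<Sum>i\<in>{i. i < dim_vec \<psi> \<and> (i div 2^n) mod 2 = 1}. (cmod (\<psi> $ i))^2)"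

definition valid_verifier :: "nat \<Rightarrow> nat \<Rightarrow> nat \<Rightarrow> nat \<Rightarrow> (nat \<Rightarrow> complex mat) \<Rightarrow> (nat \<Rightarrow> complex mat) \<Rightarrow> bool" where
  "valid_verifier n W M L U Ctl \<longleftrightarrow> W \<ge> 1 \<and> M \<ge> 1 \<and>
     (\<forall>j\<le>L. unitary_mat (full_dim n W M) (U j)) \<and>
     (\<forall>j\<in>{1..L}. proj_mat (W * M * 2) (Ctl j))"

definition uniquely_decides :: "nat \<Rightarrow> nat \<Rightarrow> nat \<Rightarrow> nat \<Rightarrow> (nat \<Rightarrow> complex mat) \<Rightarrow> (nat \<Rightarrow> complex mat)
     \<Rightarrow> complex mat set \<Rightarrow> complex mat set \<Rightarrow> real \<Rightarrow> bool" where
  "uniquely_decides n W M L U Ctl Yes No \<epsilon> \<longleftrightarrow>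
     (\<forall>Q\<in>Yes. \<exists>\<omega>. unit_state W \<omega> \<and> acc_prob n M L U Ctl Q \<omega> \<ge> 1 - \<epsilon> \<and>
        (\<forall>\<omega>'. unit_state W \<omega>' \<and> cinner \<omega> \<omega>' = 0 \<longrightarrow> acc_prob n M L U Ctl Q \<omega>' \<le> \<epsilon>)) \<and>
     (\<forall>Q\<in>No. \<forall>\<omega>. unit_state W \<omega> \<longrightarrow> acc_prob n M L U Ctl Q \<omega> \<le> \<epsilon>)"

definition orthonormal_list :: "nat \<Rightarrow> complex vec list \<Rightarrow> bool" where
  "orthonormal_list d bs \<longleftrightarrow> (\<forall>b\<in>set bs. dim_vec b = d) \<and>
     (\<forall>p<length bs. \<forall>q<length bs. cinner (bs ! p) (bs ! q) = (if p = q then 1 else 0))"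

definition proj_onto :: "nat \<Rightarrow> complex vec list \<Rightarrow> complex mat" where
  "proj_onto d bs = mat d d (\<lambda>(i,j). \<Sum>b\<leftarrow>bs. b $ i * cnj (b $ j))"

text \<open>Yes-instances: O_S = I - 2 Pi_S, S a subspace of C^(2^n) with 1 \<le> dim S \<le> 2^k
  (S given by an orthonormal basis bs, dim S = length bs).\<close>
definition reflect_yes :: "nat \<Rightarrow> nat \<Rightarrow> complex mat set" where
  "reflect_yes k n = {1\<^sub>m (2^n) - 2 \<cdot>\<^sub>m proj_onto (2^n) bs | bs.
       orthonormal_list (2^n) bs \<and> 1 \<le> length bs \<and> length bs \<le> 2^k}"

definition reflect_no :: "nat \<Rightarrow> complex mat set" where
  "reflect_no n = {1\<^sub>m (2^n)}"

end

theory Submission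
  imports Defs "HOL-Analysis.L2_Norm" "HOL-Analysis.Convex"
begin

text \<open>
  Subspaces of dimension 0, 1 and 2 spanned by basis vectors suffice, and they give the stronger
  bound \<open>L \<ge> c \<surd>(2^n)\<close> for \<open>k \<ge> 1\<close>. Let \<open>\<omega>\<^sub>a\<close> be the witness for the line spanned by \<open>e\<^sub>a\<close>.
  If \<open>L\<close> is much smaller than \<open>\<surd>(2^n)\<close>, the hybrid argument of Bennett, Bernstein, Brassard and
  Vazirani shows that a run on a fixed witness is insensitive to adding a typical basis vector to
  the subspace. Hence, for typical \<open>a \<noteq> b\<close>, the oracle for the span of \<open>e\<^sub>a\<close> and \<open>e\<^sub>b\<close> accepts both
  \<open>\<omega>\<^sub>a\<close> and \<open>\<omega>\<^sub>b\<close>, so by uniqueness these are nearly parallel; but the oracle for \<open>e\<^sub>a\<close> accepts \<open>\<omega>\<^sub>a\<close>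
  and, being close to the identity oracle on \<open>\<omega>\<^sub>b\<close>, rejects \<open>\<omega>\<^sub>b\<close>. For \<open>k = 0\<close> it is enough that
  a verifier without queries cannot depend on the oracle.
\<close>

section \<open>Euclidean norms on index sets\<close>

text \<open>The index set is a parameter so that one norm serves for whole vectors, for the part of
  a state with a fixed oracle value, and for the accepting outcomes.\<close>

definition l2norm :: "nat set \<Rightarrow> complex vec \<Rightarrow> real" where
  "l2norm I v = L2_set (\<lambda>i. cmod (v $ i)) I"

abbreviation vnorm :: "complex vec \<Rightarrow> real" where
  "vnorm v \<equiv> l2norm {..<dim_vec v} v"

lemma l2norm_nonneg [simp]: "0 \<le> l2norm I v"
  by (simp add: l2norm_def)

lemma l2norm_power2: "(l2norm I v)\<^sup>2 = (\<Sum>i\<in>I. (cmod (v $ i))\<^sup>2)"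
  by (simp add: l2norm_def L2_set_def sum_nonneg)

lemma l2norm_cong: "(\<And>i. i \<in> I \<Longrightarrow> cmod (v $ i) = cmod (w $ i)) \<Longrightarrow> l2norm I v = l2norm I w"
  unfolding l2norm_def by (rule L2_set_cong) auto

lemma l2norm_subset: "finite J \<Longrightarrow> I \<subseteq> J \<Longrightarrow> l2norm I v \<le> l2norm J v"
  unfolding l2norm_def L2_set_def by (intro real_sqrt_le_mono sum_mono2) auto

lemma l2norm_pointwise_triangle:
  assumes "\<And>i. i \<in> I \<Longrightarrow> cmod (u $ i) \<le> cmod (v $ i) + cmod (w $ i)"
  shows "l2norm I u \<le> l2norm I v + l2norm I w"
proof -
  have "l2norm I u \<le> L2_set (\<lambda>i. cmod (v $ i) + cmod (w $ i)) I"
    unfolding l2norm_def using assms by (intro L2_set_mono) auto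
  also have "\<dots> \<le> l2norm I v + l2norm I w"
    unfolding l2norm_def by (rule L2_set_triangle_ineq)
  finally show ?thesis .
qed

lemma l2norm_minus_le:
  assumes "I \<subseteq> {..<d}" "v \<in> carrier_vec d" "w \<in> carrier_vec d"
  shows "l2norm I (v - w) \<le> l2norm I v + l2norm I w"
  using assms by (intro l2norm_pointwise_triangle) (auto intro!: norm_triangle_ineq4)

lemma l2norm_le_minus:
  assumes "I \<subseteq> {..<d}" "v \<in> carrier_vec d" "w \<in> carrier_vec d"
  shows "l2norm I v \<le> l2norm I (v - w) + l2norm I w"
  using assms norm_triangle_ineq[of "v $ i - w $ i" "w $ i" for i]
  by (intro l2norm_pointwise_triangle) (auto simp: subset_eq)

lemma l2norm_smult:
  assumes "I \<subseteq> {..<d}" "v \<in> carrier_vec d"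
  shows "l2norm I (c \<cdot>\<^sub>v v) = cmod c * l2norm I v"
proof -
  have "l2norm I (c \<cdot>\<^sub>v v) = L2_set (\<lambda>i. cmod c * cmod (v $ i)) I"
    unfolding l2norm_def using assms by (intro L2_set_cong) (auto simp: norm_mult)
  thus ?thesis by (simp add: l2norm_def L2_set_right_distrib)
qed

lemma l2norm_minus_commute:
  assumes "I \<subseteq> {..<d}" "v \<in> carrier_vec d" "w \<in> carrier_vec d"
  shows "l2norm I (v - w) = l2norm I (w - v)"
  using assms by (intro l2norm_cong) (auto simp: norm_minus_commute)

lemma vnorm_diff_triangle:
  assumes "x \<in> carrier_vec d" "y \<in> carrier_vec d" "z \<in> carrier_vec d"
  shows "vnorm (x - z) \<le> vnorm (x - y) + vnorm (y - z)"
proof -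
  have "cmod (x $ i - z $ i) \<le> cmod (x $ i - y $ i) + cmod (y $ i - z $ i)" for i
    using norm_triangle_ineq[of "x $ i - y $ i" "y $ i - z $ i"] by simp
  thus ?thesis using assms by (simp, intro l2norm_pointwise_triangle) auto
qed

section \<open>Inner products, orthogonal components and unitaries\<close>

lemma cinner_self: "cinner v v = of_real ((vnorm v)\<^sup>2)"
  by (simp add: cinner_def l2norm_power2 complex_norm_square mult.commute del: of_real_power)

lemma unit_state_iff: "unit_state d v \<longleftrightarrow> v \<in> carrier_vec d \<and> vnorm v = 1"
proof -
  have "cinner v v = 1 \<longleftrightarrow> (vnorm v)\<^sup>2 = 1"
    unfolding cinner_self by (metis of_real_1 of_real_eq_iff)
  also have "\<dots> \<longleftrightarrow> vnorm v = 1"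
    using power2_eq_iff_nonneg[of "vnorm v" 1] by simp
  finally show ?thesis by (auto simp: unit_state_def)
qed

lemma cinner_minus_right:
  assumes "v \<in> carrier_vec d" "w \<in> carrier_vec d" "u \<in> carrier_vec d"
  shows "cinner u (v - w) = cinner u v - cinner u w"
  using assms by (simp add: cinner_def algebra_simps sum_subtractf)

lemma cinner_smult_right:
  assumes "v \<in> carrier_vec d" "u \<in> carrier_vec d"
  shows "cinner u (c \<cdot>\<^sub>v v) = c * cinner u v"
  using assms by (simp add: cinner_def sum_distrib_left mult_ac)

text \<open>Pythagoras for the residual of \<open>u\<close> after orthogonal projection onto the
  line of the unit vector \<open>w\<close>.\<close>

lemma vnorm_minus_component:
  assumes "unit_state d w" "unit_state d u"
  shows "(vnorm (u - cinner w u \<cdot>\<^sub>v w))\<^sup>2 = 1 - (cmod (cinner w u))\<^sup>2"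
proof -
  let ?p = "cinner w u"
  have wu: "w \<in> carrier_vec d" "u \<in> carrier_vec d"
    using assms unfolding unit_state_iff by blast+
  have [simp]: "dim_vec w = d" "dim_vec u = d" and 1: "cinner w w = 1" "cinner u u = 1"
    using assms unfolding unit_state_def by blast+
  let ?s = "u - ?p \<cdot>\<^sub>v w"
  have uw: "cinner u w = cnj ?p" by (simp add: cinner_def mult.commute)
  have lin: "cinner (u - p \<cdot>\<^sub>v w) x = cinner u x - cnj p * cinner w x" if "x \<in> carrier_vec d" for p x
    using that by (simp add: cinner_def algebra_simps sum_subtractf sum_distrib_left)
  have "cinner ?s ?s = cinner u ?s - cnj ?p * cinner w ?s" using wu by (intro lin) simp
  also have "\<dots> = 1 - ?p * cnj ?p"
    using wu 1 uw by (simp add: cinner_minus_right[where d=d] cinner_smult_right[where d=d])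
  also have "\<dots> = of_real (1 - (cmod ?p)\<^sup>2)"
    by (simp add: complex_norm_square del: of_real_power)
  finally show ?thesis
    unfolding cinner_self by (simp only: of_real_eq_iff)
qed

lemma cinner_mult_mat_vec_left:
  assumes "A \<in> carrier_mat d d" "v \<in> carrier_vec d" "w \<in> carrier_vec d"
  shows "cinner (A *\<^sub>v v) w = cinner v (adj A *\<^sub>v w)"
proof -
  have "cinner (A *\<^sub>v v) w = (\<Sum>i<d. \<Sum>j<d. cnj (A $$ (i,j)) * cnj (v $ j) * w $ i)"
    using assms by (simp add: cinner_def scalar_prod_def sum_distrib_right atLeast0LessThan)
  also have "\<dots> = (\<Sum>j<d. \<Sum>i<d. cnj (A $$ (i,j)) * cnj (v $ j) * w $ i)"
    by (rule sum.swap)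
  also have "\<dots> = cinner v (adj A *\<^sub>v w)"
    using assms by (simp add: cinner_def scalar_prod_def sum_distrib_left atLeast0LessThan adj_def mult_ac)
  finally show ?thesis .
qed

lemma vnorm_unitary:
  assumes "unitary_mat d A" "v \<in> carrier_vec d"
  shows "vnorm (A *\<^sub>v v) = vnorm v"
proof -
  have A: "A \<in> carrier_mat d d" "adj A \<in> carrier_mat d d" "adj A * A = 1\<^sub>m d"
    using assms by (auto simp: unitary_mat_def adj_def)
  have "cinner (A *\<^sub>v v) (A *\<^sub>v v) = cinner v (adj A *\<^sub>v (A *\<^sub>v v))"
    using A assms by (intro cinner_mult_mat_vec_left[where d=d]) auto
  also have "adj A *\<^sub>v (A *\<^sub>v v) = (adj A * A) *\<^sub>v v"
    using A assms by (intro assoc_mult_mat_vec[symmetric]) auto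
  also have "\<dots> = v" using A assms by simp
  finally have "(vnorm (A *\<^sub>v v))\<^sup>2 = (vnorm v)\<^sup>2"
    unfolding cinner_self of_real_eq_iff .
  thus ?thesis by (simp add: power2_eq_iff_nonneg)
qed

section \<open>Queries to diagonal reflections\<close>

text \<open>This is the oracle \<open>1 - 2P\<close> with \<open>P\<close> the projector onto the
  span of the basis vectors indexed by \<open>X\<close>. The empty set gives the identity, so Yes
  and No instances are treated uniformly.\<close>

definition diag_reflection :: "nat \<Rightarrow> nat set \<Rightarrow> complex mat" where
  "diag_reflection N X = mat N N (\<lambda>(i,j). if i = j then if i \<in> X then -1 else 1 else 0)"

lemma diag_reflection_empty: "diag_reflection N {} = 1\<^sub>m N"
  by (rule eq_matI) (auto simp: diag_reflection_def)

lemma diag_reflection_eq_proj_onto: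
  assumes "distinct xs" "set xs \<subseteq> {..<N}"
  shows "diag_reflection N (set xs) = 1\<^sub>m N - 2 \<cdot>\<^sub>m proj_onto N (map (unit_vec N) xs)"
proof -
  \<comment> \<open>Distinctness lets at most one basis vector contribute, so diagonal entries are 0
    or 1.\<close>
  have "(\<Sum>b\<leftarrow>map (unit_vec N) xs. b $ i * cnj (b $ j)) = (if i = j \<and> i \<in> set xs then 1 else 0)"
    if "i < N" "j < N" for i j
    using assms that by (induction xs) auto
  thus ?thesis
    by (intro eq_matI) (auto simp: diag_reflection_def proj_onto_def)
qed

lemma orthonormal_list_unit_vecs:
  assumes "distinct xs" "set xs \<subseteq> {..<N}"
  shows "orthonormal_list N (map (unit_vec N) xs)"
proof -
  have "cinner (unit_vec N a) (unit_vec N b) = (if a = b then 1 else 0)" if "a < N" "b < N" for a b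
  proof -
    have "cinner (unit_vec N a) (unit_vec N b) = (\<Sum>i<N. if i = a then (if a = b then 1 else 0) else 0)"
      unfolding cinner_def using that by (intro sum.cong) auto
    thus ?thesis using that by (simp add: sum.delta)
  qed
  thus ?thesis
    using assms by (auto simp: orthonormal_list_def nth_eq_iff_index_eq subset_eq)
qed

lemma diag_reflection_in_reflect_yes:
  assumes "distinct xs" "set xs \<subseteq> {..<2^n}" "1 \<le> length xs" "length xs \<le> 2^k"
  shows "diag_reflection (2^n) (set xs) \<in> reflect_yes k n"
  using orthonormal_list_unit_vecs[OF assms(1,2)] diag_reflection_eq_proj_onto[OF assms(1,2)] assms(3,4)
  unfolding reflect_yes_def by (intro CollectI exI[of _ "map (unit_vec (2^n)) xs"]) auto

lemma sum_lessThan_div_mod: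
  fixes f :: "nat \<Rightarrow> 'a :: comm_monoid_add"
  shows "(\<Sum>i<a*b. f i) = (\<Sum>p<a. \<Sum>q<b. f (p * b + q))"
proof -
  have "(\<Sum>i<a*b. f i) = (\<Sum>p<a. sum f {p*b..<p*b+b})"
    by (rule sum.nat_group[symmetric])
  also have "\<dots> = (\<Sum>p<a. \<Sum>q<b. f (p * b + q))"
    using sum.shift_bounds_nat_ivl[of f 0 "p*b" b for p] by (simp add: atLeast0LessThan add.commute)
  finally show ?thesis .
qed

text \<open>The query acts separately on the blocks of indices with a fixed value of the oracle
  register, as the identity or as the reflection \<open>1 - 2P\<close>.\<close>

lemma cquery_diag_index:
  assumes P: "P \<in> carrier_mat R R" and v: "v \<in> carrier_vec (R * N)" and r: "r < R" and a: "a < N"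
  shows "(cquery P (diag_reflection N X) *\<^sub>v v) $ (r * N + a) =
    v $ (r * N + a) - (if a \<in> X then 2 * (\<Sum>s<R. P $$ (r,s) * v $ (s * N + a)) else 0)"
proof -
  let ?Q = "diag_reflection N X" and ?s = "if a \<in> X then -1 else 1 :: complex"
  have lt: "p * N + q < R * N" if "p < R" "q < N" for p q
  proof -
    have "p * N + q < Suc p * N" using that by simp
    also have "\<dots> \<le> R * N" using that by (intro mult_right_mono) auto
    finally show ?thesis .
  qed
  have Q: "dim_row ?Q = N" "dim_col ?Q = N" by (auto simp: diag_reflection_def)
  have dims: "dim_row (cquery P ?Q) = R * N" "dim_col (cquery P ?Q) = R * N"
    using P Q by (auto simp: cquery_def kron_def)
  \<comment> \<open>Both oracle-register factors are diagonal, so only \<open>b = a\<close>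
    survives. The sign \<open>?s\<close> turns \<open>- P + ?s * P\<close> into \<open>- 2P\<close>
    for \<open>a\<close> in \<open>X\<close> and into 0 otherwise.\<close>
  have entry: "cquery P ?Q $$ (r * N + a, s * N + b) =
      (if b = a then (if s = r then 1 else 0) - P $$ (r,s) + ?s * P $$ (r,s) else 0)"
    if "s < R" "b < N" for s b
    using that P Q lt[OF r a] lt[OF that] r a
    by (auto simp: cquery_def kron_def diag_reflection_def)
  have "(cquery P ?Q *\<^sub>v v) $ (r * N + a) =
      (\<Sum>i<R*N. cquery P ?Q $$ (r * N + a, i) * v $ i)"
    using lt[OF r a] dims v by (simp add: scalar_prod_def atLeast0LessThan)
  also have "\<dots> = (\<Sum>s<R. \<Sum>b<N. cquery P ?Q $$ (r * N + a, s * N + b) * v $ (s * N + b))"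
    by (rule sum_lessThan_div_mod)
  also have "\<dots> = (\<Sum>s<R. \<Sum>b<N. if b = a then
      ((if s = r then 1 else 0) - P $$ (r,s) + ?s * P $$ (r,s)) * v $ (s * N + a) else 0)"
    by (intro sum.cong refl) (auto simp: entry)
  also have "\<dots> = (\<Sum>s<R. ((if s = r then 1 else 0) - P $$ (r,s) + ?s * P $$ (r,s)) * v $ (s * N + a))"
    using a by simp
  also have "\<dots> = (\<Sum>s<R. (if s = r then v $ (r * N + a) else 0) -
      (if a \<in> X then 2 * (P $$ (r,s) * v $ (s * N + a)) else 0))"
    by (intro sum.cong) (auto simp: algebra_simps)
  also have "\<dots> = v $ (r * N + a) - (if a \<in> X then 2 * (\<Sum>s<R. P $$ (r,s) * v $ (s * N + a)) else 0)"
    using r by (auto simp: sum_subtractf sum_distrib_left)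
  finally show ?thesis .
qed

text \<open>The matrix \<open>1 - 2P\<close> is self-adjoint, and its square is
  \<open>1 - 4P + 4P = 1\<close>.\<close>

lemma proj_mat_reflection_unitary:
  assumes "proj_mat d P"
  shows "unitary_mat d (1\<^sub>m d - 2 \<cdot>\<^sub>m P)"
proof -
  have P: "P \<in> carrier_mat d d" "adj P = P" "P * P = P" using assms by (auto simp: proj_mat_def)
  have "cnj (P $$ (j,i)) = P $$ (i,j)" if "i < d" "j < d" for i j
    using arg_cong[OF P(2), of "\<lambda>A. A $$ (i,j)"] that P(1) by (simp add: adj_def)
  hence adj: "adj (1\<^sub>m d - 2 \<cdot>\<^sub>m P) = 1\<^sub>m d - 2 \<cdot>\<^sub>m P"
    using P(1) by (intro eq_matI) (auto simp: adj_def)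
  have "(1\<^sub>m d - 2 \<cdot>\<^sub>m P) * (1\<^sub>m d - 2 \<cdot>\<^sub>m P) =
      1\<^sub>m d * (1\<^sub>m d - 2 \<cdot>\<^sub>m P) - (2 \<cdot>\<^sub>m P) * (1\<^sub>m d - 2 \<cdot>\<^sub>m P)"
    using P(1) by (intro minus_mult_distrib_mat) auto
  also have "(2 \<cdot>\<^sub>m P) * (1\<^sub>m d - 2 \<cdot>\<^sub>m P) = (2 \<cdot>\<^sub>m P) * 1\<^sub>m d - (2 \<cdot>\<^sub>m P) * (2 \<cdot>\<^sub>m P)"
    using P(1) by (intro mult_minus_distrib_mat) auto
  also have "(2 \<cdot>\<^sub>m P) * (2 \<cdot>\<^sub>m P) = 2 \<cdot>\<^sub>m (2 \<cdot>\<^sub>m P)"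
    using P by (subst mult_smult_distrib[of _ d d _ d]) (auto simp: mult_smult_assoc_mat[of _ d d _ d])
  also have "1\<^sub>m d * (1\<^sub>m d - 2 \<cdot>\<^sub>m P) - ((2 \<cdot>\<^sub>m P) * 1\<^sub>m d - 2 \<cdot>\<^sub>m (2 \<cdot>\<^sub>m P)) = 1\<^sub>m d"
    using P(1) by (intro eq_matI) auto
  finally show ?thesis using P(1) adj by (auto simp: unitary_mat_def)
qed

section \<open>Splitting states by the value of the oracle register\<close>

definition oracle_block :: "nat \<Rightarrow> nat \<Rightarrow> nat \<Rightarrow> nat set" where
  "oracle_block d N a = {i. i < d \<and> i mod N = a}"

lemma sum_oracle_block:
  fixes f :: "nat \<Rightarrow> 'a :: comm_monoid_add"
  assumes "a < N"
  shows "(\<Sum>i\<in>oracle_block (R * N) N a. f i) = (\<Sum>r<R. f (r * N + a))"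
proof -
  have "(\<Sum>i\<in>oracle_block (R * N) N a. f i) = (\<Sum>i<R*N. if i mod N = a then f i else 0)"
    unfolding oracle_block_def by (subst sum.inter_filter[symmetric]) (auto intro!: sum.cong)
  also have "\<dots> = (\<Sum>r<R. \<Sum>b<N. if b = a then f (r * N + a) else 0)"
    unfolding sum_lessThan_div_mod by (intro sum.cong refl) auto
  also have "\<dots> = (\<Sum>r<R. f (r * N + a))"
    using assms by simp
  finally show ?thesis .
qed

lemma sum_oracle_blocks:
  assumes "v \<in> carrier_vec (R * N)"
  shows "(\<Sum>a<N. (l2norm (oracle_block (R * N) N a) v)\<^sup>2) = (vnorm v)\<^sup>2"
proof -
  have "(\<Sum>a<N. (l2norm (oracle_block (R * N) N a) v)\<^sup>2) = (\<Sum>a<N. \<Sum>r<R. (cmod (v $ (r * N + a)))\<^sup>2)"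
    by (simp add: l2norm_power2 sum_oracle_block)
  also have "\<dots> = (\<Sum>i<R*N. (cmod (v $ i))\<^sup>2)"
    unfolding sum_lessThan_div_mod by (rule sum.swap)
  finally show ?thesis using assms by (simp add: l2norm_power2)
qed

text \<open>On block \<open>a\<close> the query acts as the unitary \<open>1 - 2P\<close> if
  \<open>a\<close> is in \<open>X\<close> and as the identity otherwise; it never moves amplitude
  between blocks.\<close>

lemma l2norm_block_cquery:
  assumes P: "proj_mat R P" and v: "v \<in> carrier_vec (R * N)" and a: "a < N"
  shows "l2norm (oracle_block (R * N) N a) (cquery P (diag_reflection N X) *\<^sub>v v) =
    l2norm (oracle_block (R * N) N a) v"
proof -
  let ?w = "cquery P (diag_reflection N X) *\<^sub>v v"
  let ?s = "vec R (\<lambda>r. v $ (r * N + a))"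
  let ?A = "1\<^sub>m R - 2 \<cdot>\<^sub>m P"
  have PR: "P \<in> carrier_mat R R" using P by (simp add: proj_mat_def)
  note idx = cquery_diag_index[OF PR v _ a, of _ X]
  have "(\<Sum>r<R. (cmod (?w $ (r * N + a)))\<^sup>2) = (\<Sum>r<R. (cmod (v $ (r * N + a)))\<^sup>2)"
  proof (cases "a \<in> X")
    case True
    have "(?A *\<^sub>v ?s) $ r = ?w $ (r * N + a)" if "r < R" for r
    proof -
      have "(?A *\<^sub>v ?s) $ r = (\<Sum>s<R. ((if r = s then 1 else 0) - 2 * P $$ (r,s)) * v $ (s * N + a))"
        using that PR by (simp add: scalar_prod_def atLeast0LessThan)
      also have "\<dots> = (\<Sum>s<R. (if r = s then v $ (s * N + a) else 0) - 2 * (P $$ (r,s) * v $ (s * N + a)))"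
        by (intro sum.cong) (auto simp: algebra_simps)
      also have "\<dots> = v $ (r * N + a) - 2 * (\<Sum>s<R. P $$ (r,s) * v $ (s * N + a))"
        using that by (simp add: sum_subtractf sum_distrib_left)
      finally show ?thesis using idx[OF that] True by simp
    qed
    hence "(\<Sum>r<R. (cmod (?w $ (r * N + a)))\<^sup>2) = (vnorm (?A *\<^sub>v ?s))\<^sup>2"
      using PR by (simp add: l2norm_power2)
    also have "\<dots> = (vnorm ?s)\<^sup>2"
      using vnorm_unitary[OF proj_mat_reflection_unitary[OF P], of ?s] by simp
    finally show ?thesis by (simp add: l2norm_power2)
  qed (simp add: idx)
  thus ?thesis
    by (simp add: l2norm_def L2_set_def sum_oracle_block[OF a])
qed

lemma cquery_diag_carrier:
  assumes "P \<in> carrier_mat R R"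
  shows "cquery P (diag_reflection N X) \<in> carrier_mat (R * N) (R * N)"
  using assms by (auto simp: cquery_def kron_def diag_reflection_def)

text \<open>Summing the block equalities gives the isometry without computing the adjoint of a
  Kronecker product.\<close>

lemma vnorm_cquery:
  assumes P: "proj_mat R P" and v: "v \<in> carrier_vec (R * N)"
  shows "vnorm (cquery P (diag_reflection N X) *\<^sub>v v) = vnorm v"
proof -
  let ?w = "cquery P (diag_reflection N X) *\<^sub>v v"
  have w: "?w \<in> carrier_vec (R * N)"
    using P v cquery_diag_carrier[of P R N X] by (auto simp: proj_mat_def)
  have "(vnorm ?w)\<^sup>2 = (vnorm v)\<^sup>2"
    unfolding sum_oracle_blocks[OF v, symmetric] sum_oracle_blocks[OF w, symmetric]
    by (intro sum.cong refl) (simp add: l2norm_block_cquery[OF P v])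
  thus ?thesis by (simp add: power2_eq_iff_nonneg)
qed

text \<open>The two queries agree on every block except \<open>b\<close>. On block \<open>b\<close>
  both preserve the norm, and the triangle inequality gives the factor 2.\<close>

lemma vnorm_cquery_diff:
  assumes P: "proj_mat R P" and v: "v \<in> carrier_vec (R * N)" and b: "b < N"
  shows "vnorm (cquery P (diag_reflection N X) *\<^sub>v v - cquery P (diag_reflection N (insert b X)) *\<^sub>v v)
    \<le> 2 * l2norm (oracle_block (R * N) N b) v"
proof -
  let ?q = "\<lambda>Y. cquery P (diag_reflection N Y) *\<^sub>v v"
  let ?B = "oracle_block (R * N) N"
  have PR: "P \<in> carrier_mat R R" using P by (simp add: proj_mat_def)
  have q: "?q Y \<in> carrier_vec (R * N)" for Y
    using v cquery_diag_carrier[OF PR, of N Y] by auto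
  let ?d = "?q X - ?q (insert b X)"
  have d: "?d \<in> carrier_vec (R * N)" using q by auto
  have zero: "(l2norm (?B a) ?d)\<^sup>2 = 0" if "a < N" "a \<noteq> b" for a
  proof -
    have "?d $ (r * N + a) = 0" if "r < R" for r
    proof -
      have "r * N + a < Suc r * N" using \<open>a < N\<close> by simp
      also have "\<dots> \<le> R * N" using that by (intro mult_right_mono) auto
      finally have "r * N + a < R * N" .
      moreover have "dim_row (cquery P (diag_reflection N Y)) = R * N" for Y
        using cquery_diag_carrier[OF PR, of N Y] by simp
      ultimately show ?thesis using \<open>a \<noteq> b\<close>
        by (simp add: cquery_diag_index[OF PR v that \<open>a < N\<close>] del: index_mult_mat_vec)
    qed
    thus ?thesis by (simp add: l2norm_power2 sum_oracle_block[OF \<open>a < N\<close>])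
  qed
  have "(vnorm ?d)\<^sup>2 = (\<Sum>a<N. if a = b then (l2norm (?B b) ?d)\<^sup>2 else 0)"
    unfolding sum_oracle_blocks[OF d, symmetric] using zero by (intro sum.cong) auto
  also have "\<dots> = (l2norm (?B b) ?d)\<^sup>2" using b by simp
  finally have "vnorm ?d = l2norm (?B b) ?d" by (simp add: power2_eq_iff_nonneg)
  also have "\<dots> \<le> l2norm (?B b) (?q X) + l2norm (?B b) (?q (insert b X))"
    by (rule l2norm_minus_le[OF _ q q]) (auto simp: oracle_block_def)
  also have "\<dots> = 2 * l2norm (?B b) v"
    using l2norm_block_cquery[OF P v b] by simp
  finally show ?thesis .
qed

section \<open>Runs of a verifier\<close>

locale oracle_verifier =
  fixes n W M L :: nat and U Ctl :: "nat \<Rightarrow> complex mat"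
  assumes valid: "valid_verifier n W M L U Ctl"
begin

abbreviation D :: nat where "D \<equiv> W * M * 2 * 2 ^ n"

definition state :: "nat set \<Rightarrow> complex vec \<Rightarrow> nat \<Rightarrow> complex vec" where
  "state X \<omega> j = run U Ctl (diag_reflection (2^n) X) (init_state n M \<omega>) j"

lemma unitary_U: "j \<le> L \<Longrightarrow> unitary_mat D (U j)"
  using valid by (auto simp: valid_verifier_def full_dim_def)

lemma U_carrier: "j \<le> L \<Longrightarrow> U j \<in> carrier_mat D D"
  using unitary_U by (auto simp: unitary_mat_def)

lemma proj_Ctl: "j < L \<Longrightarrow> proj_mat (W * M * 2) (Ctl (Suc j))"
  using valid by (auto simp: valid_verifier_def)

lemma query_carrier:
  "j < L \<Longrightarrow> cquery (Ctl (Suc j)) (diag_reflection (2^n) X) \<in> carrier_mat D D"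
  using proj_Ctl[of j] by (intro cquery_diag_carrier) (auto simp: proj_mat_def)

lemma init_carrier: "\<omega> \<in> carrier_vec W \<Longrightarrow> init_state n M \<omega> \<in> carrier_vec D"
  by (rule carrier_vecI) (simp add: init_state_def mult.assoc)

lemma init_minus:
  assumes "v \<in> carrier_vec W" "w \<in> carrier_vec W"
  shows "init_state n M (v - w) = init_state n M v - init_state n M w"
  using assms by (intro eq_vecI) (auto simp: init_state_def less_mult_imp_div_less)

lemma init_smult:
  assumes "v \<in> carrier_vec W"
  shows "init_state n M (c \<cdot>\<^sub>v v) = c \<cdot>\<^sub>v init_state n M v"
  using assms by (intro eq_vecI) (auto simp: init_state_def less_mult_imp_div_less)

lemma vnorm_init:
  assumes "v \<in> carrier_vec W"
  shows "vnorm (init_state n M v) = vnorm v"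
proof -
  let ?K = "M * 2 * 2^n"
  have K: "?K > 0" using valid by (simp add: valid_verifier_def)
  have dim: "dim_vec v = W" using assms by simp
  have "(\<Sum>i<W * ?K. (cmod (init_state n M v $ i))\<^sup>2) =
      (\<Sum>i<W * ?K. if i mod ?K = 0 then (cmod (v $ (i div ?K)))\<^sup>2 else 0)"
    by (intro sum.cong) (auto simp: init_state_def dim)
  \<comment> \<open>For each witness index only the all-zero auxiliary index carries amplitude; it
    lies in range because \<open>?K\<close> is positive.\<close>
  also have "\<dots> = (\<Sum>w<W. \<Sum>k<?K. if k = 0 then (cmod (v $ w))\<^sup>2 else 0)"
    unfolding sum_lessThan_div_mod[of _ W ?K] by (intro sum.cong refl) auto
  also have "\<dots> = (\<Sum>w<W. (cmod (v $ w))\<^sup>2)"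
    using K by simp
  finally show ?thesis
    by (simp add: l2norm_def L2_set_def dim init_state_def)
qed

lemma state_carrier:
  "\<omega> \<in> carrier_vec W \<Longrightarrow> j \<le> L \<Longrightarrow> state X \<omega> j \<in> carrier_vec D"
proof (induction j)
  case 0
  thus ?case using U_carrier[of 0] by (auto simp: state_def init_carrier)
next
  case (Suc j)
  thus ?case using U_carrier[of "Suc j"] query_carrier[of j X] by (auto simp: state_def)
qed

lemma state_Suc:
  "state X \<omega> (Suc j) = U (Suc j) *\<^sub>v (cquery (Ctl (Suc j)) (diag_reflection (2^n) X) *\<^sub>v state X \<omega> j)"
  by (simp add: state_def)

text \<open>Linearity in the witness, here and in \<open>state_smult\<close>, allows acceptance to
  be analysed along parallel and orthogonal components of witnesses that need not be
  normalised.\<close>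

lemma state_minus:
  assumes "v \<in> carrier_vec W" "w \<in> carrier_vec W"
  shows "j \<le> L \<Longrightarrow> state X (v - w) j = state X v j - state X w j"
proof (induction j)
  case 0
  thus ?case using assms
    by (simp add: state_def init_minus mult_minus_distrib_mat_vec[OF U_carrier] init_carrier)
next
  case (Suc j)
  let ?q = "cquery (Ctl (Suc j)) (diag_reflection (2^n) X)"
  have q: "?q \<in> carrier_mat D D" using Suc query_carrier by simp
  have c: "state X v j \<in> carrier_vec D" "state X w j \<in> carrier_vec D"
    using Suc assms state_carrier by auto
  have "?q *\<^sub>v (state X v j - state X w j) = ?q *\<^sub>v state X v j - ?q *\<^sub>v state X w j"
    by (rule mult_minus_distrib_mat_vec[OF q c])
  moreover have "U (Suc j) *\<^sub>v (?q *\<^sub>v state X v j - ?q *\<^sub>v state X w j) =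
      U (Suc j) *\<^sub>v (?q *\<^sub>v state X v j) - U (Suc j) *\<^sub>v (?q *\<^sub>v state X w j)"
    using q c by (intro mult_minus_distrib_mat_vec[OF U_carrier[OF Suc.prems]]) auto
  ultimately show ?case using Suc by (simp only: state_Suc)
qed

lemma state_smult:
  assumes "v \<in> carrier_vec W"
  shows "j \<le> L \<Longrightarrow> state X (c \<cdot>\<^sub>v v) j = c \<cdot>\<^sub>v state X v j"
proof (induction j)
  case 0
  thus ?case using assms
    by (simp add: state_def init_smult mult_mat_vec[OF U_carrier] init_carrier)
next
  case (Suc j)
  let ?q = "cquery (Ctl (Suc j)) (diag_reflection (2^n) X)"
  have q: "?q \<in> carrier_mat D D" using Suc query_carrier by simp
  have s: "state X v j \<in> carrier_vec D" using Suc assms state_carrier by auto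
  have "?q *\<^sub>v (c \<cdot>\<^sub>v state X v j) = c \<cdot>\<^sub>v (?q *\<^sub>v state X v j)"
    by (rule mult_mat_vec[OF q s])
  moreover have "U (Suc j) *\<^sub>v (c \<cdot>\<^sub>v (?q *\<^sub>v state X v j)) = c \<cdot>\<^sub>v (U (Suc j) *\<^sub>v (?q *\<^sub>v state X v j))"
    using q s by (intro mult_mat_vec[OF U_carrier[OF Suc.prems]]) auto
  ultimately show ?case using Suc by (simp only: state_Suc)
qed

lemma vnorm_state:
  assumes "\<omega> \<in> carrier_vec W"
  shows "j \<le> L \<Longrightarrow> vnorm (state X \<omega> j) = vnorm \<omega>"
proof (induction j)
  case 0
  thus ?case using vnorm_unitary[OF unitary_U[OF 0] init_carrier[OF assms]] vnorm_init[OF assms]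
    by (simp add: state_def)
next
  case (Suc j)
  let ?q = "cquery (Ctl (Suc j)) (diag_reflection (2^n) X)"
  have s: "state X \<omega> j \<in> carrier_vec D" using Suc assms state_carrier by auto
  have qs: "?q *\<^sub>v state X \<omega> j \<in> carrier_vec D" using Suc s query_carrier[of j X] by auto
  have "vnorm (state X \<omega> (Suc j)) = vnorm (?q *\<^sub>v state X \<omega> j)"
    unfolding state_Suc using vnorm_unitary[OF unitary_U[OF Suc.prems] qs] .
  also have "\<dots> = vnorm (state X \<omega> j)"
    using Suc.prems by (intro vnorm_cquery[OF proj_Ctl s]) simp
  finally show ?case using Suc by simp
qed

section \<open>The hybrid argument\<close>

definition query_weight :: "nat set \<Rightarrow> complex vec \<Rightarrow> nat \<Rightarrow> real" where
  "query_weight X \<omega> b = (\<Sum>i<L. 2 * l2norm (oracle_block D (2^n) b) (state X \<omega> i))"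

text \<open>Each query adds an error bounded by the amplitude at oracle value \<open>b\<close>, and
  the later steps, being isometries, do not amplify it. All weights refer to the run with
  \<open>X\<close> alone, which makes them summable over \<open>b\<close> for a fixed witness. The
  state with index \<open>i\<close> is the one just before query \<open>i + 1\<close>.\<close>

lemma hybrid:
  assumes \<omega>: "\<omega> \<in> carrier_vec W" and b: "b < 2^n"
  shows "j \<le> L \<Longrightarrow> vnorm (state X \<omega> j - state (insert b X) \<omega> j) \<le>
    (\<Sum>i<j. 2 * l2norm (oracle_block D (2^n) b) (state X \<omega> i))"
proof (induction j)
  case 0
  have "state X \<omega> 0 = state (insert b X) \<omega> 0" by (simp add: state_def)
  thus ?case using state_carrier[OF \<omega> 0] by (simp add: l2norm_def L2_set_def)
next
  case (Suc j)
  hence jL: "j < L" by simp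
  let ?q = "\<lambda>Y. cquery (Ctl (Suc j)) (diag_reflection (2^n) Y)"
  let ?x = "state X \<omega> j" and ?y = "state (insert b X) \<omega> j" and ?Y = "insert b X"
  have c: "?x \<in> carrier_vec D" "?y \<in> carrier_vec D" using state_carrier \<omega> jL by auto
  have qc: "?q Y *\<^sub>v ?x \<in> carrier_vec D" "?q Y *\<^sub>v ?y \<in> carrier_vec D" for Y
    using c query_carrier[OF jL, of Y] by auto
  have "state X \<omega> (Suc j) - state ?Y \<omega> (Suc j) = U (Suc j) *\<^sub>v (?q X *\<^sub>v ?x - ?q ?Y *\<^sub>v ?y)"
    unfolding state_Suc using mult_minus_distrib_mat_vec[OF U_carrier[OF Suc.prems] qc(1) qc(2)] by simp
  hence "vnorm (state X \<omega> (Suc j) - state ?Y \<omega> (Suc j)) = vnorm (?q X *\<^sub>v ?x - ?q ?Y *\<^sub>v ?y)"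
    using vnorm_unitary[OF unitary_U[OF Suc.prems], of "?q X *\<^sub>v ?x - ?q ?Y *\<^sub>v ?y"] qc by simp
  \<comment> \<open>The intermediate vector applies the enlarged oracle to the \<open>X\<close>-run:
    the first difference is the new error, the second is the old error under one common
    isometry.\<close>
  also have "\<dots> \<le> vnorm (?q X *\<^sub>v ?x - ?q ?Y *\<^sub>v ?x) + vnorm (?q ?Y *\<^sub>v ?x - ?q ?Y *\<^sub>v ?y)"
    by (rule vnorm_diff_triangle[OF qc(1) qc(1) qc(2)])
  also have "?q ?Y *\<^sub>v ?x - ?q ?Y *\<^sub>v ?y = ?q ?Y *\<^sub>v (?x - ?y)"
    using mult_minus_distrib_mat_vec[OF query_carrier[OF jL] c] by simp
  also have "vnorm \<dots> = vnorm (?x - ?y)"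
    using c by (intro vnorm_cquery[OF proj_Ctl[OF jL]]) auto
  also have "vnorm (?q X *\<^sub>v ?x - ?q ?Y *\<^sub>v ?x) \<le> 2 * l2norm (oracle_block D (2^n) b) ?x"
    by (rule vnorm_cquery_diff[OF proj_Ctl[OF jL] c(1) b])
  finally show ?case using Suc by simp
qed

text \<open>Cauchy-Schwarz over the queries costs a factor \<open>L\<close>. The squared block norms
  of each state then sum to 1, and the \<open>L\<close> states contribute the other factor
  \<open>L\<close>.\<close>

lemma sum_query_weight:
  assumes "unit_state W \<omega>"
  shows "(\<Sum>b<2^n. (query_weight X \<omega> b)\<^sup>2) \<le> 4 * (real L)\<^sup>2"
proof -
  let ?l = "\<lambda>b i. l2norm (oracle_block D (2^n) b) (state X \<omega> i)"
  have \<omega>: "\<omega> \<in> carrier_vec W" "vnorm \<omega> = 1" using assms by (auto simp: unit_state_iff)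
  have "(\<Sum>b<2^n. (query_weight X \<omega> b)\<^sup>2) \<le> (\<Sum>b<2^n. (\<Sum>i<L. (2 * ?l b i)\<^sup>2) * L)"
    unfolding query_weight_def using sum_squared_le_sum_of_squares[of "\<lambda>i. 2 * ?l b i" "{..<L}" for b]
    by (intro sum_mono) simp
  also have "\<dots> = 4 * L * (\<Sum>i<L. \<Sum>b<2^n. (?l b i)\<^sup>2)"
    by (subst sum.swap) (simp add: sum_distrib_left sum_distrib_right power_mult_distrib mult_ac)
  also have "\<dots> = 4 * L * (\<Sum>i<L. 1)"
    using sum_oracle_blocks[OF state_carrier[OF \<omega>(1)]] vnorm_state[OF \<omega>(1)] \<omega>(2) by simp
  finally show ?thesis by (simp add: power2_eq_square)
qed

section \<open>Acceptance as a seminorm\<close>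

definition accept_indices :: "nat set" where
  "accept_indices = {i. i < D \<and> (i div 2^n) mod 2 = 1}"

text \<open>This is the square root of the acceptance probability; unlike the probability, it is
  homogeneous and satisfies the triangle inequality in the witness.\<close>

definition accept_norm :: "nat set \<Rightarrow> complex vec \<Rightarrow> real" where
  "accept_norm X \<omega> = l2norm accept_indices (state X \<omega> L)"

lemma accept_indices_subset: "accept_indices \<subseteq> {..<D}"
  by (auto simp: accept_indices_def)

lemma acc_prob_eq:
  assumes "\<omega> \<in> carrier_vec W"
  shows "acc_prob n M L U Ctl (diag_reflection (2^n) X) \<omega> = (accept_norm X \<omega>)\<^sup>2"
  using state_carrier[OF assms order.refl, of X]
  by (simp add: acc_prob_def accept_norm_def l2norm_power2 accept_indices_def state_def Let_def)

lemma accept_norm_nonneg: "0 \<le> accept_norm X \<omega>"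
  by (simp add: accept_norm_def)

lemma accept_norm_le:
  assumes "\<omega> \<in> carrier_vec W"
  shows "accept_norm X \<omega> \<le> vnorm \<omega>"
proof -
  have "accept_norm X \<omega> \<le> vnorm (state X \<omega> L)"
    unfolding accept_norm_def using state_carrier[OF assms, of L X] accept_indices_subset
    by (intro l2norm_subset) auto
  thus ?thesis using vnorm_state[OF assms] by simp
qed

lemma accept_norm_le_minus:
  assumes "v \<in> carrier_vec W" "w \<in> carrier_vec W"
  shows "accept_norm X v \<le> accept_norm X (v - w) + accept_norm X w"
  unfolding accept_norm_def using assms
  by (simp add: state_minus l2norm_le_minus[OF accept_indices_subset] state_carrier)

lemma accept_norm_smult:
  assumes "v \<in> carrier_vec W"
  shows "accept_norm X (c \<cdot>\<^sub>v v) = cmod c * accept_norm X v"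
  unfolding accept_norm_def using assms
  by (simp add: state_smult l2norm_smult[OF accept_indices_subset] state_carrier)

text \<open>Restricting to the accepting indices cannot increase the distance between the final
  states, so the hybrid bound carries over.\<close>

lemma accept_norm_insert:
  assumes \<omega>: "\<omega> \<in> carrier_vec W" and b: "b < 2^n"
  shows "\<bar>accept_norm X \<omega> - accept_norm (insert b X) \<omega>\<bar> \<le> query_weight X \<omega> b"
proof -
  let ?x = "state X \<omega> L" and ?y = "state (insert b X) \<omega> L"
  have c: "?x \<in> carrier_vec D" "?y \<in> carrier_vec D" using state_carrier[OF \<omega>] by auto
  note I = accept_indices_subset
  have "l2norm accept_indices (?x - ?y) \<le> vnorm (?x - ?y)"
    using c I by (intro l2norm_subset) auto
  also have "\<dots> \<le> query_weight X \<omega> b"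
    unfolding query_weight_def by (rule hybrid[OF \<omega> b order.refl])
  finally show ?thesis
    using l2norm_le_minus[OF I c] l2norm_le_minus[OF I c(2,1)] l2norm_minus_commute[OF I c]
    unfolding accept_norm_def by linarith
qed

section \<open>Consequences of uniqueness of the accepted witness\<close>

lemma uniquely_accepted_orthogonal:
  assumes unique: "\<And>x. unit_state W x \<Longrightarrow> cinner w x = 0 \<Longrightarrow>
      acc_prob n M L U Ctl (diag_reflection (2^n) X) x \<le> \<epsilon>"
    and "\<epsilon> \<le> \<delta>\<^sup>2" "0 \<le> \<delta>" and w: "w \<in> carrier_vec W" and x: "x \<in> carrier_vec W" "cinner w x = 0"
  shows "accept_norm X x \<le> \<delta> * vnorm x"
proof (cases "vnorm x = 0")
  case True
  thus ?thesis using accept_norm_le[OF x(1), of X] by simp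
next
  case False
  \<comment> \<open>The uniqueness hypothesis speaks of unit vectors only, so \<open>x\<close> is
    normalised and the bound scaled back by homogeneity.\<close>
  define c where "c = complex_of_real (1 / vnorm x)"
  have cx: "c \<cdot>\<^sub>v x \<in> carrier_vec W" using x by simp
  have cn: "cmod c = 1 / vnorm x" by (simp add: c_def norm_divide)
  have "vnorm (c \<cdot>\<^sub>v x) = 1"
    using l2norm_smult[of "{..<W}" W x c] x False by (simp add: cn)
  hence unit: "unit_state W (c \<cdot>\<^sub>v x)" using cx by (simp add: unit_state_iff)
  have "cinner w (c \<cdot>\<^sub>v x) = 0" using cinner_smult_right[OF x(1) w] x by simp
  hence "(accept_norm X (c \<cdot>\<^sub>v x))\<^sup>2 \<le> \<delta>\<^sup>2"
    using unique[OF unit] assms(2) unfolding acc_prob_eq[OF cx] by simp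
  hence "accept_norm X (c \<cdot>\<^sub>v x) \<le> \<delta>"
    using assms(3) by (rule power2_le_imp_le)
  moreover have "0 < vnorm x" using False l2norm_nonneg[of "{..<dim_vec x}" x] by linarith
  ultimately show ?thesis
    by (simp add: accept_norm_smult[OF x(1)] cn divide_simps)
qed

text \<open>Uniqueness for the oracle \<open>Y\<close> forces the accepted witnesses \<open>u\<close> and \<open>v\<close> to be
  nearly parallel to \<open>w\<close>, hence to each other, whereas the oracle \<open>X\<close> separates them.\<close>

lemma separated_witnesses_contradiction:
  assumes units: "unit_state W u" "unit_state W v" "unit_state W w"
    and orth: "\<And>x. x \<in> carrier_vec W \<Longrightarrow> cinner w x = 0 \<Longrightarrow> accept_norm Y x \<le> 1/100 * vnorm x"
    and Y: "accept_norm Y u \<ge> 98/100" "accept_norm Y v \<ge> 98/100"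
    and X: "accept_norm X u \<ge> 99/100" "accept_norm X v \<le> 2/100"
  shows False
proof -
  have c: "u \<in> carrier_vec W" "v \<in> carrier_vec W" "w \<in> carrier_vec W" and ww: "cinner w w = 1"
    and "vnorm w = 1"
    using units unfolding unit_state_iff by (auto simp: cinner_self)
  \<comment> \<open>A witness accepted with norm 98/100 gains at most 1/100 from its component
    orthogonal to \<open>w\<close>, so its overlap with \<open>w\<close> is at least 97/100.\<close>
  have overlap: "97/100 \<le> cmod (cinner w x) \<and> cmod (cinner w x) \<le> 1 \<and> vnorm (x - cinner w x \<cdot>\<^sub>v w) \<le> 1/4"
    if x: "unit_state W x" "x \<in> carrier_vec W" "98/100 \<le> accept_norm Y x" for x
  proof -
    let ?p = "cinner w x"
    let ?s = "x - ?p \<cdot>\<^sub>v w"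
    have s: "?s \<in> carrier_vec W" using x c by simp
    have sq: "(vnorm ?s)\<^sup>2 = 1 - (cmod ?p)\<^sup>2" by (rule vnorm_minus_component[OF units(3) x(1)])
    have "(vnorm ?s)\<^sup>2 \<le> 1\<^sup>2" using sq by simp
    hence s1: "vnorm ?s \<le> 1" by (rule power2_le_imp_le) simp
    have "(cmod ?p)\<^sup>2 \<le> 1\<^sup>2" using sq zero_le_power2[of "vnorm ?s"] by (simp only: power_one)
    hence p1: "cmod ?p \<le> 1" by (rule power2_le_imp_le) simp
    have "cinner w ?s = 0"
      using x c ww by (simp add: cinner_minus_right[where d=W] cinner_smult_right[where d=W])
    hence "accept_norm Y ?s \<le> 1/100" using orth[OF s] s1 by linarith
    moreover have "accept_norm Y x \<le> accept_norm Y ?s + accept_norm Y (?p \<cdot>\<^sub>v w)"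
      using x c by (intro accept_norm_le_minus) auto
    moreover have "accept_norm Y (?p \<cdot>\<^sub>v w) \<le> cmod ?p"
      using accept_norm_le[OF c(3), of Y] \<open>vnorm w = 1\<close>
      by (simp add: accept_norm_smult[OF c(3)] mult_left_le)
    ultimately have p: "97/100 \<le> cmod ?p" using x by linarith
    hence "(97/100)\<^sup>2 \<le> (cmod ?p)\<^sup>2" by (intro power_mono) auto
    \<comment> \<open>Numerically, \<open>1 - (97/100)^2 = 0.0591\<close>, which is below
      \<open>1/16 = 0.0625\<close>.\<close>
    hence "(vnorm ?s)\<^sup>2 \<le> (1/4)\<^sup>2" unfolding sq by (simp add: power2_eq_square)
    hence "vnorm ?s \<le> 1/4" by (rule power2_le_imp_le) simp
    thus ?thesis using p p1 by simp
  qed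
  let ?p = "cinner w u" and ?q = "cinner w v"
  let ?s = "u - ?p \<cdot>\<^sub>v w" and ?r = "v - ?q \<cdot>\<^sub>v w"
  note ou = overlap[OF units(1) c(1) Y(1)] and ov = overlap[OF units(2) c(2) Y(2)]
  have sr: "?s \<in> carrier_vec W" "?r \<in> carrier_vec W" using c by simp_all
  \<comment> \<open>Cross-multiplying by the overlaps cancels the \<open>w\<close> components
    without any division; only the two short residuals remain.\<close>
  have eq: "?q \<cdot>\<^sub>v u - ?p \<cdot>\<^sub>v v = ?q \<cdot>\<^sub>v ?s - ?p \<cdot>\<^sub>v ?r"
    using c by (intro eq_vecI) (auto simp: algebra_simps)
  have "accept_norm X (?q \<cdot>\<^sub>v u - ?p \<cdot>\<^sub>v v) \<le> vnorm (?q \<cdot>\<^sub>v u - ?p \<cdot>\<^sub>v v)"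
    using c by (intro accept_norm_le) auto
  also have "\<dots> \<le> l2norm {..<W} (?q \<cdot>\<^sub>v ?s) + l2norm {..<W} (?p \<cdot>\<^sub>v ?r)"
    unfolding eq using c l2norm_minus_le[of "{..<W}" W "?q \<cdot>\<^sub>v ?s" "?p \<cdot>\<^sub>v ?r"] by simp
  also have "\<dots> = cmod ?q * vnorm ?s + cmod ?p * vnorm ?r"
    using l2norm_smult[OF order.refl sr(1), of ?q] l2norm_smult[OF order.refl sr(2), of ?p] c by simp
  also have "\<dots> \<le> 1 * (1/4) + 1 * (1/4)"
    using ou ov by (intro add_mono mult_mono) auto
  finally have 1: "accept_norm X (?q \<cdot>\<^sub>v u - ?p \<cdot>\<^sub>v v) \<le> 1/2" by simp
  have "97/100 * (99/100) \<le> cmod ?q * accept_norm X u"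
    using ov X by (intro mult_mono) auto
  also have "\<dots> = accept_norm X (?q \<cdot>\<^sub>v u)" by (simp add: accept_norm_smult[OF c(1)])
  also have "\<dots> \<le> accept_norm X (?q \<cdot>\<^sub>v u - ?p \<cdot>\<^sub>v v) + accept_norm X (?p \<cdot>\<^sub>v v)"
    using c by (intro accept_norm_le_minus) auto
  also have "accept_norm X (?p \<cdot>\<^sub>v v) = cmod ?p * accept_norm X v"
    by (simp add: accept_norm_smult[OF c(2)])
  also have "\<dots> \<le> 1 * (2/100)"
    using ou X accept_norm_nonneg by (intro mult_mono) auto
  \<comment> \<open>The chain yields \<open>0.9603 <= 1/2 + 1/50\<close>.\<close>
  finally show False using 1 by simp
qed

section \<open>Averaging over pairs of basis vectors, and the query bounds\<close>

lemma exists_light_pair: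
  assumes units: "\<And>a. a < 2^n \<Longrightarrow> unit_state W (om a)" and n: "n \<ge> 1"
    and L: "1000000 * (real L)\<^sup>2 \<le> 2^n"
  obtains a b where "a < 2^n" "b < 2^n" "a \<noteq> b" "query_weight {a} (om a) b \<le> 1/100"
    "query_weight {b} (om b) a \<le> 1/100" "query_weight {} (om b) a \<le> 1/100"
proof -
  let ?N = "2^n :: nat" and ?w = query_weight
  \<comment> \<open>The three weights control adding \<open>b\<close> to \<open>{a}\<close> on the
    witness of \<open>a\<close>, adding \<open>a\<close> to \<open>{b}\<close> on the witness of
    \<open>b\<close>, and adding \<open>a\<close> to the empty set on the witness of
    \<open>b\<close>.\<close>
  let ?g = "\<lambda>a b. (?w {a} (om a) b)\<^sup>2 + (?w {b} (om b) a)\<^sup>2 + (?w {} (om b) a)\<^sup>2"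
  have N2: "2 \<le> real ?N" using power_increasing[OF n, of "2::real"] by simp
  have "\<exists>a<?N. \<exists>b<?N. a \<noteq> b \<and> ?g a b \<le> (1/100)\<^sup>2"
  proof (rule ccontr)
    assume neg: "\<not> ?thesis"
    have "real ?N * ((real ?N - 1) * (1/100)\<^sup>2) = (\<Sum>a<?N. \<Sum>b\<in>{..<?N}-{a}. (1/100)\<^sup>2)"
      by (simp add: card_Diff_singleton)
    also have "\<dots> \<le> (\<Sum>a<?N. \<Sum>b\<in>{..<?N}-{a}. ?g a b)"
      using neg by (intro sum_mono) (metis DiffE insertCI less_eq_real_def lessThan_iff linorder_le_less_linear)
    also have "\<dots> \<le> (\<Sum>a<?N. \<Sum>b<?N. ?g a b)"
      by (intro sum_mono sum_mono2) auto
    also have "\<dots> = (\<Sum>a<?N. \<Sum>b<?N. (?w {a} (om a) b)\<^sup>2) +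
        (\<Sum>a<?N. \<Sum>b<?N. (?w {b} (om b) a)\<^sup>2) + (\<Sum>a<?N. \<Sum>b<?N. (?w {} (om b) a)\<^sup>2)"
      by (simp only: sum.distrib)
    also have "\<dots> = (\<Sum>a<?N. \<Sum>b<?N. (?w {a} (om a) b)\<^sup>2) +
        (\<Sum>b<?N. \<Sum>a<?N. (?w {b} (om b) a)\<^sup>2) + (\<Sum>b<?N. \<Sum>a<?N. (?w {} (om b) a)\<^sup>2)"
      \<comment> \<open>The weight bound needs a fixed witness, so the index of the added basis
        vector must be summed innermost.\<close>
      by (intro arg_cong2[where f="(+)"] refl sum.swap)
    also have "\<dots> \<le> (\<Sum>a<?N. 4 * (real L)\<^sup>2) + (\<Sum>b<?N. 4 * (real L)\<^sup>2) + (\<Sum>b<?N. 4 * (real L)\<^sup>2)"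
      using units by (intro add_mono sum_mono sum_query_weight) auto
    also have "\<dots> = real ?N * (12 * (real L)\<^sup>2)" by simp
    finally have "(real ?N - 1) * (1/100)\<^sup>2 \<le> 12 * (real L)\<^sup>2"
      using N2 by (simp only: mult_le_cancel_left_pos)
    hence "(real ?N - 1) * (1/10000) \<le> 12 * (real L)\<^sup>2" by (simp add: power2_eq_square)
    \<comment> \<open>With \<open>N = 2^n\<close>, the hypothesis on \<open>L\<close> gives
      \<open>N - 1 <= 0.12 * N\<close>, impossible for \<open>N >= 2\<close>.\<close>
    thus False using N2 L by (simp add: field_simps)
  qed
  then obtain a b where ab: "a < ?N" "b < ?N" "a \<noteq> b" "?g a b \<le> (1/100)\<^sup>2" by blast
  have sq: "(?w {a} (om a) b)\<^sup>2 \<le> (1/100)\<^sup>2 \<and> (?w {b} (om b) a)\<^sup>2 \<le> (1/100)\<^sup>2 \<and>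
      (?w {} (om b) a)\<^sup>2 \<le> (1/100)\<^sup>2"
    using ab(4) zero_le_power2[of "?w {a} (om a) b"] zero_le_power2[of "?w {b} (om b) a"]
      zero_le_power2[of "?w {} (om b) a"] by linarith
  have le: "x \<le> 1/100" if "x\<^sup>2 \<le> (1/100)\<^sup>2" for x :: real
    using that by (rule power2_le_imp_le) simp
  from le sq have "?w {a} (om a) b \<le> 1/100" "?w {b} (om b) a \<le> 1/100" "?w {} (om b) a \<le> 1/100"
    by blast+
  with ab that show ?thesis by blast
qed

lemma many_queries:
  assumes dec: "uniquely_decides n W M L U Ctl (reflect_yes k n) (reflect_no n) \<epsilon>"
    and \<epsilon>: "\<epsilon> \<le> 1/10000" and k: "1 \<le> k" and n: "1 \<le> n"
  shows "2^n < 1000000 * (real L)\<^sup>2"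
proof (rule ccontr)
  assume "\<not> ?thesis"
  hence L: "1000000 * (real L)\<^sup>2 \<le> 2^n" by simp
  have e: "\<epsilon> \<le> (1/100)\<^sup>2" using \<epsilon> by (simp add: power2_eq_square)
  let ?Q = "diag_reflection (2^n)"
  let ?acc = "acc_prob n M L U Ctl"
  define good where "good Q w \<longleftrightarrow> unit_state W w \<and> ?acc Q w \<ge> 1 - \<epsilon> \<and>
    (\<forall>x. unit_state W x \<and> cinner w x = 0 \<longrightarrow> ?acc Q x \<le> \<epsilon>)" for Q w
  have yes: "\<exists>w. good Q w" if "Q \<in> reflect_yes k n" for Q
    using dec that unfolding uniquely_decides_def good_def by blast
  have no: "?acc (?Q {}) x \<le> \<epsilon>" if "unit_state W x" for x
    using dec that unfolding uniquely_decides_def reflect_no_def diag_reflection_empty by blast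
  \<comment> \<open>Two-dimensional spans must be Yes instances; this is where \<open>1 <= k\<close>
    enters.\<close>
  have k2: "2 \<le> (2::nat)^k" using power_increasing[OF k, of "2::nat"] by simp
  have "\<exists>w. good (?Q {a}) w" if "a < 2^n" for a
    using diag_reflection_in_reflect_yes[of "[a]" n k] that by (intro yes) simp
  then obtain om where om: "\<And>a. a < 2^n \<Longrightarrow> good (?Q {a}) (om a)" by metis
  hence unit: "unit_state W (om a)" if "a < 2^n" for a using that by (auto simp: good_def)
  hence carrier: "om a \<in> carrier_vec W" if "a < 2^n" for a using that unfolding unit_state_iff by blast
  obtain a b where a: "a < 2^n" and b: "b < 2^n" and "a \<noteq> b"
    and w: "query_weight {a} (om a) b \<le> 1/100" "query_weight {b} (om b) a \<le> 1/100"
      "query_weight {} (om b) a \<le> 1/100"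
    using exists_light_pair[where om=om, OF unit n L] by blast
  have "\<exists>w. good (?Q {a,b}) w"
    using diag_reflection_in_reflect_yes[of "[a,b]" n k] a b \<open>a \<noteq> b\<close> k2 by (intro yes) simp
  then obtain v where v: "good (?Q {a,b}) v" by blast
  hence vu: "unit_state W v" by (simp add: good_def)
  hence vc: "v \<in> carrier_vec W" unfolding unit_state_iff by blast
  have high: "99/100 \<le> accept_norm {c} (om c)" if c: "c < 2^n" for c
  proof -
    have "1 - \<epsilon> \<le> (accept_norm {c} (om c))\<^sup>2"
      using om[OF c] unfolding good_def acc_prob_eq[OF carrier[OF c]] by blast
    \<comment> \<open>The bound on \<open>\<epsilon>\<close> gives probability at least 0.9999,
      above \<open>(99/100)^2 = 0.9801\<close>.\<close>
    hence "(99/100)\<^sup>2 \<le> (accept_norm {c} (om c))\<^sup>2" using \<epsilon> by (simp add: power2_eq_square)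
    thus ?thesis using accept_norm_nonneg by (rule power2_le_imp_le)
  qed
  have "(accept_norm {} (om b))\<^sup>2 \<le> (1/100)\<^sup>2"
    using no[OF unit[OF b]] e unfolding acc_prob_eq[OF carrier[OF b]] by linarith
  hence low: "accept_norm {} (om b) \<le> 1/100" by (rule power2_le_imp_le) simp
  show False
  \<comment> \<open>The separating oracle is \<open>{a}\<close> and the oracle with the uniqueness
    property is \<open>{a,b}\<close>, whose own witness \<open>v\<close> takes the role of the
    reference vector \<open>w\<close> there.\<close>
  proof (rule separated_witnesses_contradiction[OF unit[OF a] unit[OF b] vu])
    fix x assume x: "x \<in> carrier_vec W" "cinner v x = 0"
    show "accept_norm {a,b} x \<le> 1/100 * vnorm x"
      using v by (intro uniquely_accepted_orthogonal[OF _ e _ vc x]) (auto simp: good_def)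
  next
    \<comment> \<open>Each inserted basis vector costs at most 1/100: the norms 99/100 drop to
      98/100, and the norm 1/100 under the identity oracle rises to at most 2/100.\<close>
    show "98/100 \<le> accept_norm {a,b} (om a)"
      using accept_norm_insert[OF carrier[OF a] b, of "{a}"] w(1) high[OF a]
      by (simp add: insert_commute)
    show "98/100 \<le> accept_norm {a,b} (om b)"
      using accept_norm_insert[OF carrier[OF b] a, of "{b}"] w(2) high[OF b] by simp
    show "99/100 \<le> accept_norm {a} (om a)" by (rule high[OF a])
    show "accept_norm {a} (om b) \<le> 2/100"
      using accept_norm_insert[OF carrier[OF b] a, of "{}"] w(3) low by simp
  qed
qed

text \<open>Without queries the run never consults the oracle, so one witness would be accepted with
  probability at least \<open>1 - \<epsilon>\<close> and at most \<open>\<epsilon>\<close>.\<close>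

lemma at_least_one_query:
  assumes dec: "uniquely_decides n W M L U Ctl (reflect_yes k n) (reflect_no n) \<epsilon>" and \<epsilon>: "\<epsilon> < 1/2"
  shows "1 \<le> L"
proof (rule ccontr)
  assume "\<not> ?thesis"
  hence "L = 0" by simp
  hence indep: "acc_prob n M L U Ctl Q x = acc_prob n M L U Ctl Q' x" for Q Q' x
    by (simp add: acc_prob_def)
  have "diag_reflection (2^n) {0} \<in> reflect_yes k n"
    using diag_reflection_in_reflect_yes[of "[0]" n k] by simp
  then obtain x where "unit_state W x" "1 - \<epsilon> \<le> acc_prob n M L U Ctl (diag_reflection (2^n) {0}) x"
    using dec unfolding uniquely_decides_def by blast
  moreover have "acc_prob n M L U Ctl (1\<^sub>m (2^n)) x \<le> \<epsilon>"
    using dec \<open>unit_state W x\<close> unfolding uniquely_decides_def reflect_no_def by blast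
  ultimately show False
    using indep[of "1\<^sub>m (2^n)" x "diag_reflection (2^n) {0}"] \<epsilon> by linarith
qed

end

theorem mainTheorem1:
  fixes C :: real
  shows "\<exists>c>0. \<exists>n0. \<forall>n\<ge>n0. \<forall>k<n. \<forall>W M L U Ctl \<epsilon>.
     valid_verifier n W M L U Ctl \<and> \<epsilon> \<le> C * exp (- real n) \<and>
     uniquely_decides n W M L U Ctl (reflect_yes k n) (reflect_no n) \<epsilon>
     \<longrightarrow> c * sqrt (2 ^ k) \<le> real L"
\<comment> \<open>The constant 1/1000 is the inverse square root of the 1000000 in
  \<open>many_queries\<close>. The threshold for \<open>n\<close> forces the error below 1/10000,
  since \<open>exp n\<close> exceeds \<open>n\<close>.\<close>
proof (intro exI[of _ "1/1000 :: real"] exI[of _ "nat \<lceil>10000 * \<bar>C\<bar>\<rceil>"] conjI allI impI)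
  fix n k W M L :: nat and U Ctl :: "nat \<Rightarrow> complex mat" and \<epsilon> :: real
  assume n: "nat \<lceil>10000 * \<bar>C\<bar>\<rceil> \<le> n" and k: "k < n"
    and asm: "valid_verifier n W M L U Ctl \<and> \<epsilon> \<le> C * exp (- real n) \<and>
      uniquely_decides n W M L U Ctl (reflect_yes k n) (reflect_no n) \<epsilon>"
  interpret oracle_verifier n W M L U Ctl using asm by unfold_locales blast
  have dec: "uniquely_decides n W M L U Ctl (reflect_yes k n) (reflect_no n) \<epsilon>" using asm by blast
  have "10000 * \<bar>C\<bar> \<le> real n" using n by linarith
  also have "\<dots> \<le> exp (real n)" using exp_ge_add_one_self[of "real n"] by linarith
  finally have "C \<le> 1/10000 * exp (real n)" by linarith
  hence "C * exp (- real n) \<le> 1/10000" by (simp add: exp_minus divide_simps)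
  hence \<epsilon>: "\<epsilon> \<le> 1/10000" using asm by linarith
  show "1/1000 * sqrt (2 ^ k) \<le> real L"
  proof (cases "k = 0")
    case True
    thus ?thesis using at_least_one_query[OF dec] \<epsilon> by simp
  next
    case False
    \<comment> \<open>The bound obtained is in terms of \<open>2^n\<close> and is weakened to
      \<open>2^k\<close>.\<close>
    have "(2::real)^k \<le> 2^n" using k by (intro power_increasing) auto
    also have "\<dots> \<le> (1000 * real L)\<^sup>2"
      using many_queries[OF dec \<epsilon>] False k by (simp add: power_mult_distrib)
    finally have "sqrt (2^k) \<le> 1000 * real L" by (intro real_le_lsqrt) auto
    thus ?thesis by simp
  qed
qed simp

end
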